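(* Let $k$ be a positive integer. For all non-negative integers $m,n$ with $m>n$, $$M_{n+1}^{(k)}M_{m}^{(k)}-M_n^{(k)}M_{m+1}^{(k)}=(2^k)^{n} M_{m-n}^{(k)} .$$
   Context: The Mersenne numbers $\{M_n\}_{n\ge 0}$ are defined by $M_0=0$, $M_1=1$, $M_{n+2}=3M_{n+1}-2M_n$, i.e. $M_n=2^n-1$. For a positive integer $k$, the higher order Mersenne numbers are $M_n^{(k)}=M_{kn}/M_k$ for $n=0,1,2,\dots$. *)

theory Defs
  imports Complex_Main
begin

fun mersenne :: "nat \<Rightarrow> int" where
  "mersenne 0 = 0"
| "mersenne (Suc 0) = 1"
| "mersenne (Suc (Suc n)) = 3 * mersenne (Suc n) - 2 * mersenne n"

(* The quotient is the exact quotient in the rationals, not integer division.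
   It is meaningful for k > 0 only, since mersenne 0 = 0. *)
definition higher_mersenne :: "nat \<Rightarrow> nat \<Rightarrow> rat" where
  "higher_mersenne k n = of_int (mersenne (k * n)) / of_int (mersenne k)"

end

theory Submission
  imports Defs
begin

text \<open>With q = 2^k, \<open>higher_mersenne_eq\<close> gives the geometric quotient (q^n - 1) /
  (q - 1). Over the common denominator (q - 1)^2 the claim becomes a polynomial identity in powers
  of q.\<close>

lemma mersenne_eq: "mersenne n = 2 ^ n - 1"
  by (induction n rule: mersenne.induct) simp_all

text \<open>For k = 0 both sides are quotients by 0, hence 0.\<close>

lemma higher_mersenne_eq: "higher_mersenne k n = ((2 ^ k) ^ n - 1) / (2 ^ k - 1)"
  by (simp add: higher_mersenne_def mersenne_eq power_mult)

theorem theorem2p10: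
  fixes k m n :: nat
  assumes "k > 0" and "m > n"
  shows "higher_mersenne k (n + 1) * higher_mersenne k m
       - higher_mersenne k n * higher_mersenne k (m + 1)
       = (2 ^ k) ^ n * higher_mersenne k (m - n)"
proof -
  define q :: rat where "q = 2 ^ k"
  have "q > 1"
    using \<open>k > 0\<close> by (simp add: q_def)
  then have q: "q - 1 \<noteq> 0"
    by simp
  \<comment> \<open>Writing m as a sum avoids truncated subtraction and lets
    \<open>power_add\<close> split q^m.\<close>
  obtain d where m: "m = n + d"
    using \<open>m > n\<close> less_imp_add_positive by blast
  \<comment> \<open>The terms q^(m+n+1) and the constants cancel, leaving (q - 1) * (q^m -
    q^n).\<close>
  have "(q ^ (n + 1) - 1) * (q ^ m - 1) - (q ^ n - 1) * (q ^ (m + 1) - 1)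
      = (q - 1) * (q ^ n * (q ^ d - 1))"
    by (simp add: m power_add algebra_simps)
  then have "(q ^ (n + 1) - 1) / (q - 1) * ((q ^ m - 1) / (q - 1))
      - (q ^ n - 1) / (q - 1) * ((q ^ (m + 1) - 1) / (q - 1))
      = (q - 1) * (q ^ n * (q ^ d - 1)) / ((q - 1) * (q - 1))"
    by (simp only: times_divide_times_eq diff_divide_distrib [symmetric])
  also have "\<dots> = q ^ n * ((q ^ d - 1) / (q - 1))"
    using q by simp
  finally show ?thesis
    by (simp add: higher_mersenne_eq q_def m)
qed

end
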